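(* For every binary operation $\circ:\mathbb{N}^2\to\mathbb{N}$ and every finite coloring of $\mathbb{N}$, there is a sequence $(a_i)_{i=0}^{\infty}$ in $\mathbb{N}$ such that the set \[\bigcup_{m_0\in\mathbb{N}}\ \bigcup_{d\in \mathrm{FS}(\{a_j\}_{j=0}^{m_0-1})}\ \bigcup_{\substack{(m_1,\dots,m_d)\in\mathbb{N}^d\\ m_0<m_1<\dots<m_d}}\{(((x_1\circ x_2)\circ x_3)\circ\cdots)\circ x_d:\ x_i\in \mathrm{FS}(\{a_j\}_{j=m_{i-1}}^{m_i-1})\text{ for each }1\le i\le d\}\] is monochromatic.
   Context: $\mathbb{N}=\{1,2,\dots\}$. For a sequence $(a_j)$ in $\mathbb{N}$ and integers $m\le n$, $\mathrm{FS}(\{a_j\}_{j=m}^{n})=\{\sum_{j\in F}a_j: \emptyset\ne F\subseteq\{m,\dots,n\}\}$. For $d=1$ the expression $(((x_1\circ x_2)\circ\cdots)\circ x_d)$ means $x_1$. *)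

theory Defs
  imports Main
begin

text \<open>
  Throughout, the positive integers are rendered as the set \<open>{1..}\<close> of type \<^typ>\<open>nat set\<close>.
\<close>

definition FS :: "(nat \<Rightarrow> nat) \<Rightarrow> nat \<Rightarrow> nat \<Rightarrow> nat set" where
  "FS a m n = {\<Sum>j\<in>F. a j | F. F \<noteq> {} \<and> F \<subseteq> {m..n}}"

text \<open>
  The left-associated product of \<open>x 1, \<dots>, x d\<close>, indexed from 1.
  It is meaningful only for \<open>d \<ge> 1\<close>; the value at \<open>d = 0\<close> is a dummy.
\<close>

fun left_prod :: "(nat \<Rightarrow> nat \<Rightarrow> nat) \<Rightarrow> (nat \<Rightarrow> nat) \<Rightarrow> nat \<Rightarrow> nat" where
  "left_prod f x 0 = undefined"
| "left_prod f x (Suc 0) = x 1"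
| "left_prod f x (Suc (Suc d)) = f (left_prod f x (Suc d)) (x (Suc (Suc d)))"

text \<open>
  A tuple \<open>m\<^sub>0 < m\<^sub>1 < \<dots> < m\<^sub>d\<close> is a function \<open>m\<close> of which only the values
  on \<open>{0..d}\<close> matter. If \<open>a\<close> is a sequence of positive integers, every \<open>d\<close> occurring
  in the union is positive.
\<close>

definition product_set :: "(nat \<Rightarrow> nat \<Rightarrow> nat) \<Rightarrow> (nat \<Rightarrow> nat) \<Rightarrow> nat set" where
  "product_set f a =
     (\<Union>m0\<in>{1..}. \<Union>d\<in>FS a 0 (m0 - 1).
        \<Union>m\<in>{m :: nat \<Rightarrow> nat. m 0 = m0 \<and> strict_mono_on {0..d} m}.
          {left_prod f x d | x. \<forall>i\<in>{1..d}. x i \<in> FS a (m (i - 1)) (m i - 1)})"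

definition monochromatic :: "(nat \<Rightarrow> 'c) \<Rightarrow> nat set \<Rightarrow> bool" where
  "monochromatic c S \<longleftrightarrow> (\<exists>k. \<forall>n\<in>S. c n = k)"

end

theory Submission
  imports Defs
begin

text \<open>
  Fix an ultrafilter \<open>V\<close> on the positive integers that is idempotent for addition. For each \<open>d\<close>
  there is a color that the product of \<open>x\<^sub>1, \<dots>, x\<^sub>d\<close> has for \<open>V\<close>-almost all \<open>x\<^sub>1\<close>, for
  \<open>V\<close>-almost all \<open>x\<^sub>2\<close>, and so on, and one color \<open>k\<close> serves \<open>V\<close>-almost all \<open>d\<close>. The sequence is
  then built as in the Galvin--Glazer proof of Hindman's theorem: every finite sum of terms that
  come after a given initial segment avoids the null sets determined by that segment, which are
  finitely many. So \<open>d\<close> is admissible for \<open>k\<close>, and each successive \<open>x\<^sub>i\<close> stays in the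
  \<open>V\<close>-large set prescribed by \<open>d\<close> and the earlier factors.

  The idempotent ultrafilter is found without the topology of the space of ultrafilters: a proper
  filter that is minimal with \<open>eventually P F \<Longrightarrow> \<forall>\<^sub>F n in F. \<forall>\<^sub>F m in F. P (n + m)\<close> plays the role
  of a minimal closed subsemigroup in the Ellis--Numakura argument, and every ultrafilter below it
  is idempotent.
\<close>

section \<open>Idempotent ultrafilters\<close>

lemma chain_filter_Inf:
  fixes C :: "'a filter set"
  assumes "C \<noteq> {}" and "\<And>F G. F \<in> C \<Longrightarrow> G \<in> C \<Longrightarrow> F \<le> G \<or> G \<le> F"
  shows "eventually P (Inf C) \<longleftrightarrow> (\<exists>F\<in>C. eventually P F)"
  using assms(1)
proof (rule eventually_Inf_base)
  fix F G assume "F \<in> C" "G \<in> C"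
  then show "\<exists>x\<in>C. x \<le> inf F G"
    using assms(2)[of F G] by (metis inf.absorb_iff2 inf.orderE order_refl)
qed

text \<open>Zorn's lemma for the reversed order, with \<open>F0\<close> bounding the empty chain. It
  yields both ultrafilters and minimal additive filters.\<close>

lemma minimal_filter_exists:
  fixes F0 :: "'a filter"
  assumes "Q F0"
    and chain: "\<And>C. C \<noteq> {} \<Longrightarrow> (\<And>F. F \<in> C \<Longrightarrow> Q F) \<Longrightarrow>
      (\<And>F G. F \<in> C \<Longrightarrow> G \<in> C \<Longrightarrow> F \<le> G \<or> G \<le> F) \<Longrightarrow> Q (Inf C)"
  obtains F where "F \<le> F0" "Q F" "\<And>G. Q G \<Longrightarrow> G \<le> F \<Longrightarrow> G = F"
proof -
  define A where "A = {F. F \<le> F0 \<and> Q F}"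
  have "\<exists>m\<in>A. \<forall>G\<in>A. m \<ge> G \<longrightarrow> G = m"
  proof (rule predicate_Zorn)
    show "partial_order_on A (relation_of (\<ge>) A)"
      by (rule partial_order_on_relation_ofI) auto
    fix C assume C: "C \<in> Chains (relation_of (\<ge>) A)"
    then have sub: "C \<subseteq> A"
      by (auto simp: Chains_def relation_of_def)
    show "\<exists>u\<in>A. \<forall>a\<in>C. a \<ge> u"
    proof (cases "C = {}")
      case True
      then show ?thesis using assms(1) by (auto simp: A_def)
    next
      case False
      have "Q (Inf C)"
        using False sub C by (intro chain) (auto simp: A_def Chains_def relation_of_def)
      moreover have "Inf C \<le> F0"
        using False sub by (auto simp: A_def intro: Inf_lower2)
      ultimately show ?thesis
        by (intro bexI[of _ "Inf C"]) (auto simp: A_def Inf_lower)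
    qed
  qed
  then obtain m where m: "m \<in> A" "\<And>G. G \<in> A \<Longrightarrow> G \<le> m \<Longrightarrow> G = m"
    by blast
  show thesis
  proof (rule that)
    show "m \<le> F0" "Q m" using m(1) by (auto simp: A_def)
    fix G assume "Q G" "G \<le> m"
    with \<open>m \<le> F0\<close> have "G \<in> A" by (auto simp: A_def)
    then show "G = m" using m(2) \<open>G \<le> m\<close> by blast
  qed
qed

definition ultrafilter :: "'a filter \<Rightarrow> bool" where
  "ultrafilter V \<longleftrightarrow> V \<noteq> bot \<and> (\<forall>P. eventually P V \<or> eventually (\<lambda>x. \<not> P x) V)"

text \<open>A minimal proper filter is an ultrafilter: if the complement of \<open>P\<close> is not
  large, restricting to \<open>P\<close> leaves a proper filter, which by minimality changes
  nothing.\<close>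

lemma ultrafilter_exists:
  fixes F :: "'a filter"
  assumes "F \<noteq> bot"
  obtains V where "V \<le> F" "ultrafilter V"
proof (rule minimal_filter_exists[of "\<lambda>F. F \<noteq> bot" F])
  show "Inf C \<noteq> bot" if "C \<noteq> {}" "\<And>F. F \<in> C \<Longrightarrow> F \<noteq> bot"
    "\<And>F G. F \<in> C \<Longrightarrow> G \<in> C \<Longrightarrow> F \<le> G \<or> G \<le> F" for C :: "'a filter set"
    using that chain_filter_Inf[of C "\<lambda>_. False"] by (auto simp: trivial_limit_def)
  fix V assume V: "V \<le> F" "V \<noteq> bot" and min: "\<And>G. G \<noteq> bot \<Longrightarrow> G \<le> V \<Longrightarrow> G = V"
  have "eventually P V \<or> eventually (\<lambda>x. \<not> P x) V" for P
  proof (rule disjCI)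
    assume "\<not> eventually (\<lambda>x. \<not> P x) V"
    then have "inf V (principal {x. P x}) \<noteq> bot"
      by (auto simp: trivial_limit_def eventually_inf_principal)
    then have "inf V (principal {x. P x}) = V"
      by (rule min) simp
    moreover have "eventually P (inf V (principal {x. P x}))"
      by (simp add: eventually_inf_principal)
    ultimately show "eventually P V"
      by simp
  qed
  with V show thesis
    by (intro that) (auto simp: ultrafilter_def)
qed (use assms in auto)

lemma ultrafilter_finite_bex:
  assumes "ultrafilter V" "finite K" "\<forall>\<^sub>F x in V. \<exists>k\<in>K. P k x"
  shows "\<exists>k\<in>K. \<forall>\<^sub>F x in V. P k x"
proof (rule ccontr)
  assume "\<not> ?thesis"
  then have "\<forall>\<^sub>F x in V. \<forall>k\<in>K. \<not> P k x"
    using assms(1,2) by (intro eventually_ball_finite) (auto simp: ultrafilter_def)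
  with assms(3) have "\<forall>\<^sub>F x in V. False"
    by eventually_elim blast
  with assms(1) show False
    by (simp add: ultrafilter_def trivial_limit_def)
qed

text \<open>In terms of the sum below this is \<open>sum_filter F F \<le> F\<close>. It makes the
  ultrafilters below \<open>F\<close> closed under addition; for an ultrafilter it amounts to
  idempotence.\<close>

definition additive_filter :: "'a::plus filter \<Rightarrow> bool" where
  "additive_filter F \<longleftrightarrow> (\<forall>P. eventually P F \<longrightarrow> (\<forall>\<^sub>F n in F. \<forall>\<^sub>F m in F. P (n + m)))"

lemma additive_filterD:
  "additive_filter F \<Longrightarrow> eventually P F \<Longrightarrow> \<forall>\<^sub>F n in F. \<forall>\<^sub>F m in F. P (n + m)"
  by (simp add: additive_filter_def)

definition sum_filter :: "'a::plus filter \<Rightarrow> 'a filter \<Rightarrow> 'a filter" where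
  "sum_filter F G = Abs_filter (\<lambda>P. \<forall>\<^sub>F n in F. \<forall>\<^sub>F m in G. P (n + m))"

lemma eventually_sum_filter:
  "eventually P (sum_filter F G) \<longleftrightarrow> (\<forall>\<^sub>F n in F. \<forall>\<^sub>F m in G. P (n + m))"
  unfolding sum_filter_def
proof (rule eventually_Abs_filter, rule is_filter.intro)
  fix P Q :: "'a \<Rightarrow> bool"
  show "\<forall>\<^sub>F n in F. \<forall>\<^sub>F m in G. P (n + m) \<and> Q (n + m)"
    if "\<forall>\<^sub>F n in F. \<forall>\<^sub>F m in G. P (n + m)" "\<forall>\<^sub>F n in F. \<forall>\<^sub>F m in G. Q (n + m)"
    using that by (simp add: eventually_conj_iff)
  show "\<forall>\<^sub>F n in F. \<forall>\<^sub>F m in G. Q (n + m)"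
    if imp: "\<forall>x. P x \<longrightarrow> Q x" and P: "\<forall>\<^sub>F n in F. \<forall>\<^sub>F m in G. P (n + m)"
    using P by (rule eventually_mono) (use imp in \<open>auto elim: eventually_mono\<close>)
qed simp

text \<open>
  For an ultrafilter \<open>V\<close>, the ultrafilters below \<open>stabilizer_filter F V\<close> are the ultrafilters
  \<open>U \<le> F\<close> with \<open>sum_filter U V = V\<close>.
\<close>

definition stabilizer_filter :: "'a::plus filter \<Rightarrow> 'a filter \<Rightarrow> 'a filter" where
  "stabilizer_filter F V =
     Abs_filter (\<lambda>P. \<exists>A. eventually A V \<and> (\<forall>\<^sub>F n in F. (\<forall>\<^sub>F m in V. A (n + m)) \<longrightarrow> P n))"

lemma eventually_stabilizer_filter:
  "eventually P (stabilizer_filter F V) \<longleftrightarrow>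
     (\<exists>A. eventually A V \<and> (\<forall>\<^sub>F n in F. (\<forall>\<^sub>F m in V. A (n + m)) \<longrightarrow> P n))"
  unfolding stabilizer_filter_def
proof (rule eventually_Abs_filter, rule is_filter.intro)
  show "\<exists>A. eventually A V \<and> (\<forall>\<^sub>F n in F. (\<forall>\<^sub>F m in V. A (n + m)) \<longrightarrow> True)"
    by (intro exI[of _ "\<lambda>_. True"]) simp
  fix P Q :: "'a \<Rightarrow> bool"
  assume "\<exists>A. eventually A V \<and> (\<forall>\<^sub>F n in F. (\<forall>\<^sub>F m in V. A (n + m)) \<longrightarrow> P n)"
  then obtain A where A: "eventually A V" "\<forall>\<^sub>F n in F. (\<forall>\<^sub>F m in V. A (n + m)) \<longrightarrow> P n"
    by blast
  {
    assume "\<exists>A. eventually A V \<and> (\<forall>\<^sub>F n in F. (\<forall>\<^sub>F m in V. A (n + m)) \<longrightarrow> Q n)"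
    then obtain B where B: "eventually B V" "\<forall>\<^sub>F n in F. (\<forall>\<^sub>F m in V. B (n + m)) \<longrightarrow> Q n"
      by blast
    have "\<forall>\<^sub>F n in F. (\<forall>\<^sub>F m in V. A (n + m) \<and> B (n + m)) \<longrightarrow> P n \<and> Q n"
      using A(2) B(2) by eventually_elim (simp add: eventually_conj_iff)
    then show "\<exists>A. eventually A V \<and>
        (\<forall>\<^sub>F n in F. (\<forall>\<^sub>F m in V. A (n + m)) \<longrightarrow> P n \<and> Q n)"
      using A(1) B(1) by (intro exI[of _ "\<lambda>x. A x \<and> B x"]) (simp add: eventually_conj_iff)
  }
  assume "\<forall>x. P x \<longrightarrow> Q x"
  with A show "\<exists>A. eventually A V \<and> (\<forall>\<^sub>F n in F. (\<forall>\<^sub>F m in V. A (n + m)) \<longrightarrow> Q n)"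
    by (intro exI[of _ A]) (auto elim: eventually_mono)
qed

text \<open>The analogue of the left ideal S + p of a semigroup S containing p. Writing + for
  \<open>sum_filter\<close>, associativity and F + F \<le> F give F + (F + V) \<le> F + V, and the
  outer F may be shrunk to F + V.\<close>

lemma additive_sum_filter:
  fixes F V :: "'a::semigroup_add filter"
  assumes F: "additive_filter F" and "V \<le> F"
  shows "sum_filter F V \<le> F" "additive_filter (sum_filter F V)"
proof -
  show le: "sum_filter F V \<le> F"
  proof (rule filter_leI)
    fix P assume "eventually P F"
    from additive_filterD[OF F this] show "eventually P (sum_filter F V)"
      unfolding eventually_sum_filter
      by (rule eventually_mono) (use \<open>V \<le> F\<close> in \<open>auto intro: filter_leD\<close>)
  qed
  show "additive_filter (sum_filter F V)"
    unfolding additive_filter_def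
  proof (intro allI impI)
    fix P assume "eventually P (sum_filter F V)"
    then have "\<forall>\<^sub>F n in F. \<forall>\<^sub>F m in V. P (n + m)"
      by (simp add: eventually_sum_filter)
    from additive_filterD[OF F this]
    have "\<forall>\<^sub>F n in F. \<forall>\<^sub>F m in sum_filter F V. P (n + m)"
      by (simp add: eventually_sum_filter add.assoc)
    then show "\<forall>\<^sub>F n in sum_filter F V. \<forall>\<^sub>F m in sum_filter F V. P (n + m)"
      by (rule filter_leD[OF le])
  qed
qed

text \<open>The analogue of: the u with u + p = p form a semigroup. If the translate of
  \<open>A\<close> by \<open>n\<close> is \<open>V\<close>-large, that translate serves as the
  witness for the inner quantifier.\<close>

lemma additive_stabilizer_filter:
  fixes F V :: "'a::semigroup_add filter"
  assumes F: "additive_filter F"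
  shows "stabilizer_filter F V \<le> F" "additive_filter (stabilizer_filter F V)"
proof -
  let ?G = "stabilizer_filter F V"
  show le: "?G \<le> F"
    by (rule filter_leI) (auto simp: eventually_stabilizer_filter
        intro!: exI[of _ "\<lambda>_. True"] elim: eventually_mono)
  show "additive_filter ?G"
    unfolding additive_filter_def
  proof (intro allI impI)
    fix P assume "eventually P ?G"
    then obtain A where A: "eventually A V"
      and P: "\<forall>\<^sub>F n in F. (\<forall>\<^sub>F m in V. A (n + m)) \<longrightarrow> P n"
      by (auto simp: eventually_stabilizer_filter)
    from additive_filterD[OF F P]
    have "\<forall>\<^sub>F n in F. (\<forall>\<^sub>F m in V. A (n + m)) \<longrightarrow> eventually (\<lambda>m. P (n + m)) ?G"
    proof eventually_elim
      case (elim n)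
      then show ?case
        by (auto simp: eventually_stabilizer_filter add.assoc intro!: exI[of _ "\<lambda>m. A (n + m)"])
    qed
    with A show "\<forall>\<^sub>F n in ?G. \<forall>\<^sub>F m in ?G. P (n + m)"
      unfolding eventually_stabilizer_filter[of "\<lambda>n. \<forall>\<^sub>F m in ?G. P (n + m)"] by blast
  qed
qed

lemma additive_ultrafilter_exists:
  fixes F0 :: "'a::semigroup_add filter"
  assumes "F0 \<noteq> bot" "additive_filter F0"
  obtains V where "V \<le> F0" "ultrafilter V" "additive_filter V"
proof -
  obtain F where F: "F \<le> F0" "F \<noteq> bot" "additive_filter F"
    and min: "\<And>G. G \<noteq> bot \<Longrightarrow> additive_filter G \<Longrightarrow> G \<le> F \<Longrightarrow> G = F"
  proof (rule minimal_filter_exists[of "\<lambda>F. F \<noteq> bot \<and> additive_filter F" F0])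
    fix C :: "'a filter set"
    assume C: "C \<noteq> {}" "\<And>F. F \<in> C \<Longrightarrow> F \<noteq> bot \<and> additive_filter F"
      "\<And>F G. F \<in> C \<Longrightarrow> G \<in> C \<Longrightarrow> F \<le> G \<or> G \<le> F"
    note ev = chain_filter_Inf[OF C(1,3)]
    have "Inf C \<noteq> bot"
      using C(2) ev[of "\<lambda>_. False"] by (auto simp: trivial_limit_def)
    moreover have "additive_filter (Inf C)"
      unfolding additive_filter_def
    proof (intro allI impI)
      fix P assume "eventually P (Inf C)"
      then obtain F where "F \<in> C" "eventually P F"
        using ev[of P] by auto
      have le: "Inf C \<le> F"
        using \<open>F \<in> C\<close> by (rule Inf_lower)
      have "additive_filter F"
        using C(2) \<open>F \<in> C\<close> by simp
      then have "\<forall>\<^sub>F n in F. \<forall>\<^sub>F m in F. P (n + m)"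
        using \<open>eventually P F\<close> by (rule additive_filterD)
      then have "\<forall>\<^sub>F n in F. \<forall>\<^sub>F m in Inf C. P (n + m)"
        by (rule eventually_mono) (rule filter_leD[OF le])
      then show "\<forall>\<^sub>F n in Inf C. \<forall>\<^sub>F m in Inf C. P (n + m)"
        by (rule filter_leD[OF le])
    qed
    ultimately show "Inf C \<noteq> bot \<and> additive_filter (Inf C)" by blast
  qed (use assms in auto)
  obtain V where V: "V \<le> F" "ultrafilter V"
    using F(2) ultrafilter_exists by blast
  have V_bot: "V \<noteq> bot"
    using V(2) by (simp add: ultrafilter_def)
  have "sum_filter F V \<noteq> bot"
    using V_bot F(2) by (simp add: trivial_limit_def eventually_sum_filter)
  then have sum: "sum_filter F V = F"
    using additive_sum_filter[OF F(3) V(1)] min by blast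
  \<comment> \<open>Otherwise some \<open>V\<close>-large \<open>A\<close> has \<open>V\<close>-null
    translates by \<open>F\<close>-almost all \<open>n\<close>. The complement of \<open>A\<close>
    is then large for \<open>sum_filter F V\<close>, which is \<open>F\<close>, hence also for
    \<open>V\<close>.\<close>
  have "stabilizer_filter F V \<noteq> bot"
  proof
    assume "stabilizer_filter F V = bot"
    then have "eventually (\<lambda>_. False) (stabilizer_filter F V)"
      by (simp add: trivial_limit_def)
    then obtain A where A: "eventually A V" "\<forall>\<^sub>F n in F. \<not> (\<forall>\<^sub>F m in V. A (n + m))"
      unfolding eventually_stabilizer_filter by auto
    from A(2) have "\<forall>\<^sub>F n in F. \<forall>\<^sub>F m in V. \<not> A (n + m)"
      by (rule eventually_mono) (use V(2) in \<open>auto simp: ultrafilter_def\<close>)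
    then have "\<forall>\<^sub>F n in sum_filter F V. \<not> A n"
      by (simp add: eventually_sum_filter)
    then have "\<forall>\<^sub>F n in V. \<not> A n"
      unfolding sum by (rule filter_leD[OF V(1)])
    with A(1) have "\<forall>\<^sub>F n in V. False"
      by eventually_elim blast
    with V_bot show False
      by (simp add: trivial_limit_def)
  qed
  then have stab: "stabilizer_filter F V = F"
    using additive_stabilizer_filter[OF F(3)] min by blast
  \<comment> \<open>\<open>V\<close> lies below \<open>F\<close>, now equal to
    \<open>stabilizer_filter F V\<close>, so \<open>V\<close> stabilizes itself; the witness
    \<open>A\<close> is \<open>P\<close>.\<close>
  have "additive_filter V"
    unfolding additive_filter_def
  proof (intro allI impI)
    fix P assume "eventually P V"
    then have "\<forall>\<^sub>F n in stabilizer_filter F V. \<forall>\<^sub>F m in V. P (n + m)"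
      unfolding eventually_stabilizer_filter by (intro exI[of _ P]) simp
    then show "\<forall>\<^sub>F n in V. \<forall>\<^sub>F m in V. P (n + m)"
      unfolding stab by (rule filter_leD[OF V(1)])
  qed
  with V F(1) show thesis
    by (intro that) auto
qed

section \<open>Finite sums with prescribed tails\<close>

lemma additive_filter_sums:
  fixes V :: "'a::comm_monoid_add filter"
  assumes V: "additive_filter V" "V \<noteq> bot" and \<Phi>: "\<And>h. eventually (\<Phi> h) V"
  obtains a :: "nat \<Rightarrow> 'a"
  where "\<And>m J. finite J \<Longrightarrow> J \<noteq> {} \<Longrightarrow> J \<subseteq> {m..} \<Longrightarrow> \<Phi> (map a [0..<m]) (sum a J)"
proof -
  \<comment> \<open>A state holds the terms \<open>h\<close> chosen so far and a large set
    \<open>W\<close> that must contain all later sums. The next term \<open>x\<close> lies in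
    \<open>W\<close> and has a large translate W - x; the new set lies inside both and satisfies
    \<open>\<Phi>\<close> for the longer history.\<close>
  define P where "P = (\<lambda>n (h, W). length h = n \<and> eventually W V \<and> (\<forall>y. W y \<longrightarrow> \<Phi> h y))"
  define Q where "Q = (\<lambda>(h, W) (h', W').
    \<exists>x::'a. W x \<and> h' = h @ [x] \<and> (\<forall>y. W' y \<longrightarrow> W y \<and> W (x + y)))"
  have "\<exists>s. \<forall>n. P n (s n) \<and> Q (s n) (s (Suc n))"
  proof (rule dependent_nat_choice)
    show "\<exists>s. P 0 s"
      by (rule exI[of _ "([], \<Phi> [])"]) (simp add: P_def \<Phi>)
    fix s n assume "P n s"
    then obtain h W where s: "s = (h, W)" "length h = n" "eventually W V"
      by (auto simp: P_def)
    have "\<forall>\<^sub>F x in V. W x \<and> (\<forall>\<^sub>F y in V. W (x + y))"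
      using s(3) additive_filterD[OF V(1) s(3)] by (rule eventually_conj)
    then obtain x where x: "W x" "\<forall>\<^sub>F y in V. W (x + y)"
      using V(2) eventually_happens' by blast
    show "\<exists>s'. P (Suc n) s' \<and> Q s s'"
      by (rule exI[of _ "(h @ [x], \<lambda>y. W y \<and> W (x + y) \<and> \<Phi> (h @ [x]) y)"])
        (use s x \<Phi> in \<open>auto simp: P_def Q_def eventually_conj_iff\<close>)
  qed
  then obtain s where s: "\<And>n. P n (s n)" "\<And>n. Q (s n) (s (Suc n))"
    by blast
  define h W where "h = (\<lambda>n. fst (s n))" and "W = (\<lambda>n. snd (s n))"
  have len: "length (h n) = n" and W: "W n y \<Longrightarrow> \<Phi> (h n) y" for n y
    using s(1)[of n] by (auto simp: P_def h_def W_def split: prod.splits)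
  have "\<exists>x. W n x \<and> h (Suc n) = h n @ [x] \<and> (\<forall>y. W (Suc n) y \<longrightarrow> W n y \<and> W n (x + y))" for n
    using s(2)[of n] by (auto simp: Q_def h_def W_def split: prod.splits)
  then obtain a where a: "\<And>n. W n (a n)" "\<And>n. h (Suc n) = h n @ [a n]"
    "\<And>n y. W (Suc n) y \<Longrightarrow> W n y" "\<And>n y. W (Suc n) y \<Longrightarrow> W n (a n + y)"
    by metis
  have h: "h n = map a [0..<n]" for n
    by (induction n) (use len[of 0] a(2) in auto)
  have decr: "W m y" if "m \<le> n" "W n y" for m n y
    using that by (induction rule: dec_induct) (auto intro: a(3))
  have "W m (sum a J)" if "finite J" "J \<noteq> {}" "J \<subseteq> {m..}" for m J
    using that
  proof (induction "card J" arbitrary: J m rule: less_induct)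
    case less
    define j where "j = Min J"
    have j: "j \<in> J" "m \<le> j" and tail: "J - {j} \<subseteq> {Suc j..}"
      using less.prems by (auto simp: j_def Suc_le_eq less_le)
    \<comment> \<open>Split off the least index \<open>j\<close>: the remaining sum lies in
      \<open>W (Suc j)\<close>, so adding \<open>a j\<close> lands in \<open>W j\<close>.\<close>
    have "W j (sum a J)"
    proof (cases "J = {j}")
      case True
      then show ?thesis using a(1) by simp
    next
      case False
      with j(1) have "J - {j} \<noteq> {}" by blast
      then have "W (Suc j) (sum a (J - {j}))"
        using less.prems(1) tail card_Diff1_less[OF less.prems(1) j(1)]
        by (intro less.hyps) simp_all
      then show ?thesis
        using a(4) less.prems(1) j(1) by (metis sum.remove)
    qed
    then show ?case using j(2) decr by blast
  qed
  then show thesis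
    using that W h by metis
qed

section \<open>Iterated quantifiers\<close>

primrec iterated_eventually :: "'a filter \<Rightarrow> ('a list \<Rightarrow> bool) \<Rightarrow> nat \<Rightarrow> 'a list \<Rightarrow> bool" where
  "iterated_eventually V P 0 l = P l"
| "iterated_eventually V P (Suc r) l = (\<forall>\<^sub>F x in V. iterated_eventually V P r (l @ [x]))"

text \<open>The finite choice of \<open>k\<close> is pulled outward through one quantifier at a
  time, by the ultrafilter pigeonhole principle.\<close>

lemma iterated_eventually_finite_bex:
  assumes V: "ultrafilter V" and K: "finite K" and X: "\<forall>\<^sub>F x in V. x \<in> X"
    and P: "\<And>l. length l = d \<Longrightarrow> set l \<subseteq> X \<Longrightarrow> \<exists>k\<in>K. P k l"
    and "length l + r = d" "set l \<subseteq> X"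
  shows "\<exists>k\<in>K. iterated_eventually V (P k) r l"
  using assms(5,6)
proof (induction r arbitrary: l)
  case 0
  then show ?case using P by simp
next
  case (Suc r)
  from X have "\<forall>\<^sub>F x in V. \<exists>k\<in>K. iterated_eventually V (P k) r (l @ [x])"
    by (rule eventually_mono) (use Suc in auto)
  then show ?case
    using ultrafilter_finite_bex[OF V K] by simp
qed

text \<open>For each single \<open>l\<close> and \<open>r\<close> the premise is by definition that
  almost all \<open>y\<close> satisfy the conclusion. The bound \<open>s\<close> leaves finitely
  many pairs, so one large set serves all.\<close>

lemma eventually_iterated_eventually:
  fixes V :: "nat filter"
  shows "\<forall>\<^sub>F y in V. \<forall>l r. set l \<subseteq> {..s} \<longrightarrow> length l \<le> s \<longrightarrow> r \<le> s \<longrightarrow>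
    iterated_eventually V P (Suc r) l \<longrightarrow> iterated_eventually V P r (l @ [y])"
proof -
  let ?L = "{l. set l \<subseteq> {..s} \<and> length l \<le> s}"
  have "\<forall>\<^sub>F y in V. \<forall>(l, r)\<in>?L \<times> {..s}.
      iterated_eventually V P (Suc r) l \<longrightarrow> iterated_eventually V P r (l @ [y])"
    by (rule eventually_ball_finite) (auto simp: finite_lists_length_le)
  then show ?thesis
    by (rule eventually_mono) auto
qed

section \<open>Left-associated products and the coloring argument\<close>

lemma left_prod_cong:
  assumes "d \<ge> 1" "\<And>i. i \<in> {1..d} \<Longrightarrow> x i = y i"
  shows "left_prod f x d = left_prod f y d"
  using assms
proof (induction d rule: dec_induct)
  case (step d)
  then show ?case by (cases d) auto
qed simp

lemma left_prod_closed:
  assumes "\<And>x y. x \<in> X \<Longrightarrow> y \<in> X \<Longrightarrow> f x y \<in> X"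
    and "d \<ge> 1" "\<And>i. i \<in> {1..d} \<Longrightarrow> x i \<in> X"
  shows "left_prod f x d \<in> X"
  using assms(2,3)
proof (induction d rule: dec_induct)
  case (step d)
  then show ?case using assms(1) by (cases d) auto
qed simp

lemma additive_principal_pos: "additive_filter (principal {1::nat..})"
  by (auto simp: additive_filter_def eventually_principal)

text \<open>Lets the total of an initial segment bound both the number of factors and every factor
  formed from that segment.\<close>

lemma FS_le_sum_list:
  assumes "x \<in> FS a m n" "n < N"
  shows "x \<le> sum_list (map a [0..<N])"
proof -
  from assms obtain J where "x = sum a J" "J \<subseteq> {0..<N}"
    by (fastforce simp: FS_def)
  then show ?thesis
    by (auto simp: interv_sum_list_conv_sum_set_nat intro: sum_mono2)
qed

theorem theorem1p10:
  fixes f :: "nat \<Rightarrow> nat \<Rightarrow> nat" and c :: "nat \<Rightarrow> 'c"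
  assumes "\<And>x y. x \<in> {1..} \<Longrightarrow> y \<in> {1..} \<Longrightarrow> f x y \<in> {1..}"
    and "finite (c ` {1..})"
  shows "\<exists>a :: nat \<Rightarrow> nat. (\<forall>i. a i \<in> {1..}) \<and> monochromatic c (product_set f a)"
proof -
  obtain V where V: "V \<le> principal {1::nat..}" "ultrafilter V" "additive_filter V"
    using additive_ultrafilter_exists[OF _ additive_principal_pos]
    by (auto simp: principal_eq_bot_iff)
  have V_bot: "V \<noteq> bot"
    using V(2) by (simp add: ultrafilter_def)
  have pos: "\<forall>\<^sub>F x in V. x \<in> {1..}"
    using V(1) by (rule filter_leD) (simp add: eventually_principal)
  \<comment> \<open>The shift reconciles lists, indexed from 0, with \<open>left_prod\<close>,
    indexed from 1.\<close>
  define P where "P = (\<lambda>k l. c (left_prod f (\<lambda>i. l ! (i - 1)) (length l)) = k)"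
  have "\<exists>k\<in>c ` {1..}. iterated_eventually V (P k) d []" if "d \<in> {1..}" for d
  proof (rule iterated_eventually_finite_bex[OF V(2) assms(2) pos, where d = d])
    fix l :: "nat list" assume "length l = d" "set l \<subseteq> {1..}"
    have "l ! (i - 1) \<in> {1..}" if "i \<in> {1..length l}" for i
      using \<open>set l \<subseteq> {1..}\<close> by (rule subsetD) (use that in \<open>auto intro: nth_mem\<close>)
    then have "left_prod f (\<lambda>i. l ! (i - 1)) (length l) \<in> {1..}"
      using assms(1) \<open>d \<in> {1..}\<close> \<open>length l = d\<close> by (intro left_prod_closed) auto
    then show "\<exists>k\<in>c ` {1..}. P k l"
      by (auto simp: P_def)
  qed auto
  then have "\<forall>\<^sub>F d in V. \<exists>k\<in>c ` {1..}. iterated_eventually V (P k) d []"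
    using pos by (auto elim: eventually_mono)
  then obtain k where k: "\<forall>\<^sub>F d in V. iterated_eventually V (P k) d []"
    by (blast dest: ultrafilter_finite_bex[OF V(2) assms(2),
          where P = "\<lambda>k d. iterated_eventually V (P k) d []"])
  \<comment> \<open>The second conjunct makes sums admissible as \<open>d\<close>, the third as a
    next factor. \<open>sum_list h\<close> caps everything an earlier segment can prescribe:
    factors, their number, and the number still to come.\<close>
  define \<Phi> where "\<Phi> = (\<lambda>h y. y \<in> {1..} \<and> iterated_eventually V (P k) y [] \<and>
    (\<forall>l r. set l \<subseteq> {..sum_list h} \<longrightarrow> length l \<le> sum_list h \<longrightarrow> r \<le> sum_list h \<longrightarrow>
      iterated_eventually V (P k) (Suc r) l \<longrightarrow> iterated_eventually V (P k) r (l @ [y])))"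
  have "eventually (\<Phi> h) V" for h
    unfolding \<Phi>_def by (intro eventually_conj pos k eventually_iterated_eventually)
  then obtain a where a: "\<And>m J. finite J \<Longrightarrow> J \<noteq> {} \<Longrightarrow> J \<subseteq> {m..} \<Longrightarrow>
      \<Phi> (map a [0..<m]) (sum a J)"
    using additive_filter_sums[OF V(3) V_bot] by blast
  have FS: "\<Phi> (map a [0..<m]) x" if "x \<in> FS a m n" for m n x
    using that a by (auto simp: FS_def intro!: a intro: finite_subset)
  have "a i \<in> {1..}" for i
    using a[of "{i}" i] by (simp add: \<Phi>_def)
  moreover have "c (left_prod f x d) = k"
    if m0: "m 0 \<ge> 1" and d: "d \<in> FS a 0 (m 0 - 1)" and m: "strict_mono_on {0..d} m"
      and x: "\<forall>i\<in>{1..d}. x i \<in> FS a (m (i - 1)) (m i - 1)" for m d x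
  proof -
    have d1: "d \<ge> 1" "iterated_eventually V (P k) d []"
      using FS[OF d] by (auto simp: \<Phi>_def)
    have mono: "m i \<le> m j" if "i \<le> j" "j \<le> d" for i j
      using that strict_mono_onD[OF m, of i j] by (cases "i = j") auto
    \<comment> \<open>Invariant: \<open>i\<close> factors are fixed and \<open>d - i\<close>
      quantifiers remain.\<close>
    have "iterated_eventually V (P k) (d - i) (map x [1..<Suc i])" if "i \<le> d" for i
      using that
    proof (induction i)
      case 0
      then show ?case using d1 by simp
    next
      case (Suc i)
      let ?s = "sum_list (map a [0..<m i])"
      have pos_m: "m j \<ge> 1" if "j \<le> d" for j
        using mono[of 0 j] m0 that by simp
      \<comment> \<open>Bounds both the length \<open>i\<close> and the remaining count. As
        \<open>m 0\<close> is positive, the truncated \<open>m 0 - 1\<close> stays below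
        \<open>m i\<close>.\<close>
      have "d \<le> ?s"
        using Suc.prems mono[of 0 i] m0 by (intro FS_le_sum_list[OF d]) auto
      moreover have "set (map x [1..<Suc i]) \<subseteq> {..?s}"
      proof -
        have "x j \<le> ?s" if "j \<in> {1..i}" for j
        proof -
          have "x j \<in> FS a (m (j - 1)) (m j - 1)"
            using x that Suc.prems by auto
          then show ?thesis
            using mono[of j i] pos_m[of j] that Suc.prems by (intro FS_le_sum_list) auto
        qed
        then show ?thesis by auto
      qed
      moreover have "iterated_eventually V (P k) (Suc (d - Suc i)) (map x [1..<Suc i])"
        using Suc by (simp add: Suc_diff_Suc del: upt_Suc iterated_eventually.simps)
      moreover have "\<Phi> (map a [0..<m i]) (x (Suc i))"
        using x Suc.prems by (intro FS[where n = "m (Suc i) - 1"]) (metis One_nat_def Suc_le_mono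
            atLeastAtMost_iff diff_Suc_1 le0)
      ultimately have "iterated_eventually V (P k) (d - Suc i) (map x [1..<Suc i] @ [x (Suc i)])"
        using Suc.prems unfolding \<Phi>_def by (simp del: upt_Suc iterated_eventually.simps)
      then show ?case by simp
    qed
    from this[of d] have "P k (map x [1..<Suc d])"
      by (simp del: upt_Suc)
    moreover have "left_prod f (\<lambda>i. map x [1..<Suc d] ! (i - 1)) d = left_prod f x d"
      using d1(1) by (intro left_prod_cong) (auto simp del: upt_Suc)
    ultimately show ?thesis
      by (simp add: P_def del: upt_Suc)
  qed
  then have "monochromatic c (product_set f a)"
    unfolding monochromatic_def product_set_def by (intro exI[of _ k]) auto
  ultimately show ?thesis by blast
qed

end
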